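(* Let $Q=\prod_{j=1}^n(a_j,b_j)\subset\mathbb R^n$ with $a_j<b_j$, let $p=(p_1,\ldots,p_n)\in Q$, and let $F:\mathbb D\to Q$ be a harmonic map with $F(0)=p$ that is extremal, that is, $$\|dF_0\|=\left(\sum_{j=1}^n A_j(p_j)^2\right)^{1/2},\qquad A_j(p_j)=\frac{2(b_j-a_j)}{\pi}\sin\frac{\pi(p_j-a_j)}{b_j-a_j}.$$ Then the real differential $dF_0:\mathbb R^2\to\mathbb R^n$ has one-dimensional image.
   Context: $\mathbb D=\{z\in\mathbb C:|z|<1\}$. A map into $\mathbb R^n$ is harmonic if each component is harmonic. $\|dF_0\|$ is the operator norm of the real differential $dF_0:\mathbb R^2\to\mathbb R^n$ with respect to the Euclidean norms. The right-hand side of the displayed equality is the largest possible value of $\|dF_0\|$ over harmonic $F:\mathbb D\to Q$ with $F(0)=p$. *)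

theory Defs
  imports "HOL-Analysis.Analysis"
begin

(* \<open>u'\<close> and \<open>u''\<close> are the first and second total derivatives, so \<open>u\<close> is twice continuously
   differentiable, and \<open>u'' z e e\<close> is the pure second partial derivative in the direction \<open>e\<close>:
   the last conjunct says that the Laplacian of \<open>u\<close> vanishes. *)
definition harmonic_on :: "('a::euclidean_space \<Rightarrow> real) \<Rightarrow> 'a set \<Rightarrow> bool" where
  "harmonic_on u S \<longleftrightarrow> open S \<and>
     (\<exists>(u' :: 'a \<Rightarrow> 'a \<Rightarrow>\<^sub>L real) (u'' :: 'a \<Rightarrow> 'a \<Rightarrow>\<^sub>L 'a \<Rightarrow>\<^sub>L real).
        (\<forall>z\<in>S. (u has_derivative blinfun_apply (u' z)) (at z)) \<and>
        (\<forall>z\<in>S. (u' has_derivative blinfun_apply (u'' z)) (at z)) \<and>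
        continuous_on S u'' \<and>
        (\<forall>z\<in>S. (\<Sum>e\<in>Basis. blinfun_apply (blinfun_apply (u'' z) e) e) = 0))"

definition harmonic_map_on :: "('a::euclidean_space \<Rightarrow> real ^ 'n) \<Rightarrow> 'a set \<Rightarrow> bool" where
  "harmonic_map_on F S \<longleftrightarrow> (\<forall>j. harmonic_on (\<lambda>z. F z $ j) S)"

(* The quantity \<open>A\<^sub>j(t)\<close> of the interval with endpoints \<open>\<alpha> = a\<^sub>j\<close> and \<open>\<beta> = b\<^sub>j\<close>. *)
definition schwarz_bound :: "real \<Rightarrow> real \<Rightarrow> real \<Rightarrow> real" where
  "schwarz_bound \<alpha> \<beta> t = 2 * (\<beta> - \<alpha>) / pi * sin (pi * (t - \<alpha>) / (\<beta> - \<alpha>))"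

(* \<open>frechet_derivative F (at 0)\<close> is the real differential: the complex plane is here the
   two-dimensional Euclidean space with norm \<open>cmod\<close>, and \<open>onorm\<close> is the operator norm for the
   Euclidean norms. *)
definition extremal_at_0 :: "real ^ 'n \<Rightarrow> real ^ 'n \<Rightarrow> real ^ 'n \<Rightarrow> (complex \<Rightarrow> real ^ 'n) \<Rightarrow> bool" where
  "extremal_at_0 a b p F \<longleftrightarrow>
     onorm (frechet_derivative F (at 0)) = sqrt (\<Sum>j\<in>UNIV. (schwarz_bound (a $ j) (b $ j) (p $ j))\<^sup>2)"

end

(* Each component of F is the real part of a holomorphic function f with values in a vertical
   strip, and the Schwarz lemma bounds the gradient of F_j at 0 by A_j(p_j).  Let v be a unit
   vector at which the operator norm of dF_0 is attained.  Extremality forces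
   |dF_j(v)| = A_j(p_j) for every j at once, so each component attains its gradient bound in the
   direction v; every gradient is then a multiple of v, and dF_0(w) = <v, w> dF_0(v). *)
theory Submission
  imports Defs "HOL-Complex_Analysis.Conformal_Mappings"
begin

section \<open>Symmetry of second derivatives; harmonic functions as real parts\<close>

lemma second_derivative_symmetric:
  fixes u :: "'a::real_normed_vector \<Rightarrow> real"
  assumes "open S" "z \<in> S"
    and u': "\<And>w. w \<in> S \<Longrightarrow> (u has_derivative blinfun_apply (u' w)) (at w)"
    and u'': "(u' has_derivative blinfun_apply u'') (at z)"
  shows "blinfun_apply (blinfun_apply u'' e) f = blinfun_apply (blinfun_apply u'' f) e"
proof (rule ccontr)
  \<comment> \<open>The mixed second difference of \<open>u\<close> is symmetric in \<open>e\<close> and \<open>f\<close>, and the mean value theorem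
     identifies it with \<open>s\<^sup>2 * u'' e f\<close> up to an error \<open>o(s\<^sup>2)\<close>.\<close>
  define M where "M = norm e + norm f + 1"
  have M: "norm e + norm f < M" "0 < M" "norm e \<le> M" "norm f \<le> M"
    unfolding M_def by (auto simp: add_nonneg_pos)
  assume "u'' e f \<noteq> u'' f e"
  \<comment> \<open>The factor 8 makes the combined error
    \<open>4 * \<epsilon> * s\<^sup>2 * M\<^sup>2\<close> of the two orders of differencing half of
    \<open>s\<^sup>2 * \<bar>u'' e f - u'' f e\<bar>\<close>, the quantity it must dominate.\<close>
  define \<epsilon> where "\<epsilon> = \<bar>u'' e f - u'' f e\<bar> / (8 * M\<^sup>2)"
  have \<epsilon>: "\<epsilon> > 0"
    using \<open>u'' e f \<noteq> u'' f e\<close> M by (simp add: \<epsilon>_def)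
  obtain d1 where d1: "d1 > 0" "\<And>w. norm (w - z) < d1 \<Longrightarrow>
      norm (u' w - u' z - u'' (w - z)) \<le> \<epsilon> * norm (w - z)"
    using u'' \<epsilon> unfolding has_derivative_at_alt by blast
  obtain d2 where d2: "d2 > 0" "ball z d2 \<subseteq> S"
    using assms(1,2) open_contains_ball by blast
  \<comment> \<open>Every point used below lies within \<open>s * M\<close> of \<open>z\<close>,
    hence inside \<open>S\<close> and where the linearisation of \<open>u'\<close> is accurate up to
    \<open>\<epsilon>\<close>.\<close>
  define s where "s = min d1 d2 / (2 * M)"
  have s: "s > 0" "s * M < d1" "s * M < d2"
    using d1 d2 M by (auto simp: s_def field_simps min_def)
  have diff: "\<bar>(u (z + s *\<^sub>R x + s *\<^sub>R y) - u (z + s *\<^sub>R y) - u (z + s *\<^sub>R x) + u z) - s\<^sup>2 * u'' x y\<bar>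
      \<le> 2 * \<epsilon> * s\<^sup>2 * M\<^sup>2" if xy: "norm x + norm y < M" for x y
  proof -
    \<comment> \<open>The increment of \<open>u\<close> along one edge while the base point slides
      along the other; \<open>g 1 - g 0\<close> is the mixed second difference, so one mean value
      theorem in \<open>t\<close> reduces it to a difference of first derivatives.\<close>
    define g where "g t = u (z + s *\<^sub>R x + (t * s) *\<^sub>R y) - u (z + (t * s) *\<^sub>R y)" for t
    have yM: "norm y \<le> M" using xy norm_ge_zero[of x] by linarith
    have small: "norm (r *\<^sub>R (s *\<^sub>R x) + (t * s) *\<^sub>R y) < s * M"
      if "0 \<le> t" "t \<le> 1" "0 \<le> r" "r \<le> 1" for t r
    proof -
      have "norm (r *\<^sub>R (s *\<^sub>R x) + (t * s) *\<^sub>R y) \<le> r * s * norm x + t * s * norm y"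
        using that s by (intro order.trans[OF norm_triangle_ineq]) simp
      also have "\<dots> \<le> 1 * s * norm x + 1 * s * norm y"
        using that s by (intro add_mono mult_right_mono) auto
      also have "\<dots> < s * M"
        using xy s by (simp flip: distrib_left)
      finally show ?thesis .
    qed
    have inS: "z + s *\<^sub>R x + (t * s) *\<^sub>R y \<in> S" "z + (t * s) *\<^sub>R y \<in> S" if "0 \<le> t" "t \<le> 1" for t
    proof -
      have "dist z (z + s *\<^sub>R x + (t * s) *\<^sub>R y) < d2"
        using small[OF that, of 1] s by (subst dist_commute) (simp add: dist_norm add.assoc)
      moreover have "dist z (z + (t * s) *\<^sub>R y) < d2"
        using small[OF that, of 0] s by (simp add: dist_norm)
      ultimately show "z + s *\<^sub>R x + (t * s) *\<^sub>R y \<in> S" "z + (t * s) *\<^sub>R y \<in> S"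
        using d2 by (auto simp: subset_iff)
    qed
    have g': "(g has_derivative (\<lambda>h. u' (z + s *\<^sub>R x + (t * s) *\<^sub>R y) ((h * s) *\<^sub>R y)
        - u' (z + (t * s) *\<^sub>R y) ((h * s) *\<^sub>R y))) (at t)" if "0 \<le> t" "t \<le> 1" for t
    proof -
      have "((\<lambda>t. c + (t * s) *\<^sub>R y) has_derivative (\<lambda>h. (h * s) *\<^sub>R y)) (at t)" for c
        by (auto intro!: derivative_eq_intros)
      from has_derivative_diff[OF has_derivative_compose[OF this u'[OF inS(1)[OF that]]]
          has_derivative_compose[OF this u'[OF inS(2)[OF that]]]]
      show ?thesis unfolding g_def .
    qed
    obtain t where t: "0 < t" "t < 1"
      "g 1 - g 0 = u' (z + s *\<^sub>R x + (t * s) *\<^sub>R y) (((1 - 0) * s) *\<^sub>R y)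
        - u' (z + (t * s) *\<^sub>R y) (((1 - 0) * s) *\<^sub>R y)"
    proof -
      from mvt_simple[OF zero_less_one has_derivative_at_withinI[OF g']]
      show thesis using that by (metis greaterThanLessThan_iff)
    qed
    \<comment> \<open>The two points compared differ by \<open>s *\<^sub>R x\<close>: in the linear
      parts the \<open>y\<close> contributions cancel, leaving \<open>s *\<^sub>R u'' x\<close> and
      two remainders.\<close>
    define R where "R w = u' w - u' z - u'' (w - z)" for w
    have R: "norm (R (z + w)) \<le> \<epsilon> * (s * M)" if "norm w < s * M" for w
    proof -
      have "norm (R (z + w)) \<le> \<epsilon> * norm w"
        using d1(2)[of "z + w"] that s unfolding R_def by simp
      also have "\<dots> \<le> \<epsilon> * (s * M)"
        using that \<epsilon> by simp
      finally show ?thesis .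
    qed
    have "u' (z + s *\<^sub>R x + (t * s) *\<^sub>R y) - u' (z + (t * s) *\<^sub>R y)
      = s *\<^sub>R u'' x + (R (z + (s *\<^sub>R x + (t * s) *\<^sub>R y)) - R (z + (t * s) *\<^sub>R y))"
      by (simp add: R_def blinfun.bilinear_simps algebra_simps)
    then have "u' (z + s *\<^sub>R x + (t * s) *\<^sub>R y) y - u' (z + (t * s) *\<^sub>R y) y
      = s * u'' x y + (R (z + (s *\<^sub>R x + (t * s) *\<^sub>R y)) - R (z + (t * s) *\<^sub>R y)) y"
      by (metis blinfun.add_left blinfun.diff_left blinfun.scaleR_left real_scaleR_def)
    moreover have "g 1 - g 0
      = s * (u' (z + s *\<^sub>R x + (t * s) *\<^sub>R y) y - u' (z + (t * s) *\<^sub>R y) y)"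
      unfolding t(3) by (simp add: blinfun.scaleR_right right_diff_distrib)
    ultimately have "g 1 - g 0 - s\<^sup>2 * u'' x y
      = s * ((R (z + (s *\<^sub>R x + (t * s) *\<^sub>R y)) - R (z + (t * s) *\<^sub>R y)) y)"
      by (simp only: distrib_left power2_eq_square mult.assoc)
    also have "\<bar>\<dots>\<bar> \<le> s * ((2 * \<epsilon> * (s * M)) * norm y)"
    proof -
      have "norm (R (z + (s *\<^sub>R x + (t * s) *\<^sub>R y)) - R (z + (t * s) *\<^sub>R y))
          \<le> \<epsilon> * (s * M) + \<epsilon> * (s * M)"
        using small[of t 1] small[of t 0] t
        by (intro order.trans[OF norm_triangle_ineq4] add_mono R) auto
      then have "norm ((R (z + (s *\<^sub>R x + (t * s) *\<^sub>R y)) - R (z + (t * s) *\<^sub>R y)) y)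
          \<le> (2 * \<epsilon> * (s * M)) * norm y"
        by (intro order.trans[OF norm_blinfun] mult_right_mono) (auto simp: mult_ac)
      then show ?thesis
        using s by (simp add: abs_mult)
    qed
    also have "\<dots> \<le> s * ((2 * \<epsilon> * (s * M)) * M)"
      using s \<epsilon> M yM by (intro mult_left_mono) auto
    also have "\<dots> = 2 * \<epsilon> * s\<^sup>2 * M\<^sup>2"
      by (simp add: power2_eq_square mult_ac)
    also have "g 1 - g 0 = u (z + s *\<^sub>R x + s *\<^sub>R y) - u (z + s *\<^sub>R y) - u (z + s *\<^sub>R x) + u z"
      by (simp add: g_def)
    finally show ?thesis .
  qed
  \<comment> \<open>Exchanging \<open>e\<close> and \<open>f\<close> leaves the second difference
    unchanged, so it drops out by the triangle inequality.\<close>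
  have "\<bar>s\<^sup>2 * u'' e f - s\<^sup>2 * u'' f e\<bar> \<le> 4 * \<epsilon> * s\<^sup>2 * M\<^sup>2"
    using diff[of e f] diff[of f e] M(1) by (simp add: add_ac)
  moreover have "\<bar>s\<^sup>2 * u'' e f - s\<^sup>2 * u'' f e\<bar> = s\<^sup>2 * \<bar>u'' e f - u'' f e\<bar>"
    by (simp add: abs_mult flip: right_diff_distrib)
  moreover have "4 * \<epsilon> * s\<^sup>2 * M\<^sup>2 = s\<^sup>2 * (\<bar>u'' e f - u'' f e\<bar> / 2)"
    using M(2) by (simp add: \<epsilon>_def)
  ultimately have "s\<^sup>2 * \<bar>u'' e f - u'' f e\<bar> \<le> s\<^sup>2 * (\<bar>u'' e f - u'' f e\<bar> / 2)"
    by linarith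
  then have "\<bar>u'' e f - u'' f e\<bar> \<le> \<bar>u'' e f - u'' f e\<bar> / 2"
    by (rule mult_left_le_imp_le) (use s in simp)
  then show False
    using \<open>u'' e f \<noteq> u'' f e\<close> by simp
qed

lemma harmonic_on_eq_Re_holomorphic:
  fixes u :: "complex \<Rightarrow> real"
  assumes "convex S" "harmonic_on u S"
  obtains f where "f holomorphic_on S" "\<And>z. z \<in> S \<Longrightarrow> u z = Re (f z)"
proof -
  from assms(2) obtain u' u'' where "open S"
    and u': "\<And>z. z \<in> S \<Longrightarrow> (u has_derivative blinfun_apply (u' z)) (at z)"
    and u'': "\<And>z. z \<in> S \<Longrightarrow> (u' has_derivative blinfun_apply (u'' z)) (at z)"
    and lap: "\<And>z. z \<in> S \<Longrightarrow> (\<Sum>e\<in>Basis. u'' z e e) = 0"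
    unfolding harmonic_on_def by blast
  \<comment> \<open>The Cauchy-Riemann equations of \<open>g\<close> are \<open>\<Delta>u = 0\<close> and the symmetry of the second derivative;
     the primitive of \<open>g\<close> has real part \<open>u\<close> up to a constant.\<close>
  define g where "g z = of_real (u' z 1) - \<i> * of_real (u' z \<i>)" for z
  have decomp: "h = Re h *\<^sub>R 1 + Im h *\<^sub>R \<i>" for h
    by (simp add: complex_eq_iff)
  have g': "(g has_field_derivative (of_real (u'' z 1 1) - \<i> * of_real (u'' z 1 \<i>))) (at z)"
    if z: "z \<in> S" for z
  proof -
    have sym: "u'' z \<i> 1 = u'' z 1 \<i>"
      by (rule second_derivative_symmetric[OF \<open>open S\<close> z u' u''[OF z]])
    have lap': "u'' z \<i> \<i> = - u'' z 1 1"
      using lap[OF z] by (simp add: Basis_complex_def)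
    have dd: "((\<lambda>w. u' w e) has_derivative (\<lambda>h. u'' z h e)) (at z)" for e
      using bounded_linear.has_derivative[OF blinfun.bounded_linear_left u''[OF z]] .
    have "(g has_derivative (\<lambda>h. of_real (u'' z h 1) - \<i> * of_real (u'' z h \<i>))) (at z)"
      unfolding g_def
      by (intro has_derivative_diff has_derivative_mult_right
          bounded_linear.has_derivative[OF bounded_linear_of_real] dd)
    moreover have "(\<lambda>h. of_real (u'' z h 1) - \<i> * of_real (u'' z h \<i>))
       = (*) (of_real (u'' z 1 1) - \<i> * of_real (u'' z 1 \<i>))"
    proof
      fix h
      have "u'' z h e = Re h * u'' z 1 e + Im h * u'' z \<i> e" for e
        using arg_cong[OF decomp[of h], of "\<lambda>k. u'' z k e"]
        by (simp only: blinfun.bilinear_simps real_scaleR_def)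
      then show "of_real (u'' z h 1) - \<i> * of_real (u'' z h \<i>)
          = (of_real (u'' z 1 1) - \<i> * of_real (u'' z 1 \<i>)) * h"
        by (simp add: sym lap' complex_eq_iff)
    qed
    ultimately show ?thesis
      by (simp only: has_field_derivative_def)
  qed
  then have "g holomorphic_on S"
    using \<open>open S\<close> holomorphic_on_open by blast
  then obtain f where "\<And>z. z \<in> S \<Longrightarrow> (f has_field_derivative g z) (at z within S)"
    using holomorphic_convex_primitive' assms(1) \<open>open S\<close> by metis
  then have f: "(f has_field_derivative g z) (at z)" if "z \<in> S" for z
    using that \<open>open S\<close> by (simp add: at_within_open[of _ S])
  have "((\<lambda>w. u w - Re (f w)) has_derivative (\<lambda>h. 0)) (at z within S)" if z: "z \<in> S" for z
  proof -
    have "((\<lambda>w. u w - Re (f w)) has_derivative (\<lambda>h. u' z h - Re (g z * h))) (at z)"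
      using f[OF z] by (intro has_derivative_diff u' z
          bounded_linear.has_derivative[OF bounded_linear_Re]) (simp add: has_field_derivative_def)
    \<comment> \<open>The minus sign in \<open>g\<close> gives
      \<open>Re (g z * h) = u' z 1 * Re h + u' z \<i> * Im h\<close>.\<close>
    moreover have "u' z h - Re (g z * h) = 0" for h
      by (subst (1) decomp[of h]) (simp add: g_def blinfun.bilinear_simps)
    ultimately show ?thesis
      by (simp add: has_derivative_at_withinI)
  qed
  from has_derivative_zero_constant[OF assms(1) this]
  obtain c where c: "\<And>z. z \<in> S \<Longrightarrow> u z - Re (f z) = c"
    by blast
  show thesis
  proof
    show "(\<lambda>z. f z + of_real c) holomorphic_on S"
      using f \<open>open S\<close> by (intro holomorphic_intros) (meson holomorphic_on_open)
    show "u z = Re (f z + of_real c)" if "z \<in> S" for z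
      using c[OF that] by simp
  qed
qed

section \<open>Schwarz lemma for a strip and the gradient bound\<close>

lemma norm_deriv_holomorphic_strip_le:
  assumes f: "f holomorphic_on ball 0 1"
    and strip: "\<And>z. z \<in> ball 0 1 \<Longrightarrow> 0 < Re (f z) \<and> Re (f z) < pi"
  shows "norm (deriv f 0) \<le> 2 * sin (Re (f 0))"
proof -
  \<comment> \<open>\<open>g\<close> maps into the upper half-plane; the Cayley transform \<open>h\<close> of \<open>g\<close> fixes \<open>0\<close> and maps into the disc.\<close>
  define g where "g z = exp (\<i> * f z)" for z
  have Im_g: "Im (g z) > 0" if "z \<in> ball 0 1" for z
    using strip[OF that] by (simp add: g_def Im_exp sin_gt_zero)
  define h where "h z = (g z - g 0) / (g z - cnj (g 0))" for z
  have ne: "g z - cnj (g 0) \<noteq> 0" if "z \<in> ball 0 1" for z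
  proof
    assume "g z - cnj (g 0) = 0"
    then have "Im (g z) = - Im (g 0)" by (simp add: complex_eq_iff)
    then show False using Im_g[OF that] Im_g[of 0] by simp
  qed
  have f0: "(f has_field_derivative deriv f 0) (at 0)"
    using f by (intro holomorphic_derivI[of _ "ball 0 1"]) auto
  have g0: "(g has_field_derivative (g 0 * (\<i> * deriv f 0))) (at 0)"
    unfolding g_def by (rule derivative_eq_intros f0 refl | simp)+
  have h0: "(h has_field_derivative (g 0 * (\<i> * deriv f 0)) / (g 0 - cnj (g 0))) (at 0)"
  proof -
    have "((\<lambda>z. g z - w) has_field_derivative (g 0 * (\<i> * deriv f 0))) (at 0)" for w
      using DERIV_diff[OF g0 DERIV_const] by simp
    from DERIV_divide[OF this[of "g 0"] this[of "cnj (g 0)"]] ne[of 0] show ?thesis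
      unfolding h_def by simp
  qed
  have "norm (deriv h 0) \<le> 1"
  proof (rule Schwarz_Lemma(2))
    show "h holomorphic_on ball 0 1"
      unfolding h_def using ne by (auto intro!: holomorphic_intros f simp: g_def)
    show "h 0 = 0" by (simp add: h_def)
    show "norm (h z) < 1" if "norm z < 1" for z
    proof -
      \<comment> \<open>The squared distances from \<open>g z\<close> to \<open>cnj (g 0)\<close>
        and to \<open>g 0\<close> differ by \<open>4 * Im (g z) * Im (g 0)\<close>.\<close>
      have "0 < Im (g z) * Im (g 0)" using Im_g that by simp
      then have "(norm (g z - g 0))\<^sup>2 < (norm (g z - cnj (g 0)))\<^sup>2"
        unfolding cmod_power2 by (simp add: power2_eq_square algebra_simps)
      then have "norm (g z - g 0) < norm (g z - cnj (g 0))"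
        by (rule power2_less_imp_less) simp
      moreover have "norm (g z - cnj (g 0)) > 0"
        using ne[of z] that by simp
      ultimately show ?thesis by (simp add: h_def norm_divide)
    qed
    show "norm (0::complex) < 1" by simp
  qed
  \<comment> \<open>The denominator of \<open>deriv h 0\<close> has modulus
    \<open>2 * Im (g 0)\<close>, and \<open>Im (g 0) = norm (g 0) * sin (Re (f 0))\<close>, so
    \<open>norm (g 0)\<close> cancels in the end.\<close>
  then have "norm (g 0) * norm (deriv f 0) \<le> norm (g 0 - cnj (g 0))"
    using DERIV_imp_deriv[OF h0] ne[of 0]
    by (simp add: norm_divide norm_mult divide_simps split: if_splits)
  also have "norm (g 0 - cnj (g 0)) = 2 * Im (g 0)"
    using Im_g[of 0] by (simp add: complex_diff_cnj norm_mult)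
  also have "\<dots> = norm (g 0) * (2 * sin (Re (f 0)))"
    by (simp add: g_def Im_exp norm_exp_eq_Re)
  finally show ?thesis
    by (simp add: g_def)
qed

text \<open>An affine map carries the strip between \<open>\<alpha>\<close> and
  \<open>\<beta>\<close> to the one of width \<open>pi\<close>; with
  \<open>c = pi / (\<beta> - \<alpha>)\<close> the bound reads
  \<open>2 / c * sin (c * (u 0 - \<alpha>))\<close>. The differential of \<open>u\<close> is the
  real part of multiplication by \<open>deriv f 0\<close>.\<close>

lemma harmonic_schwarz:
  fixes u :: "complex \<Rightarrow> real"
  assumes "\<alpha> < \<beta>" "harmonic_on u (ball 0 1)"
    and bounds: "\<And>z. z \<in> ball 0 1 \<Longrightarrow> \<alpha> < u z \<and> u z < \<beta>"
    and D: "(u has_derivative D) (at 0)"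
  shows "\<bar>D h\<bar> \<le> schwarz_bound \<alpha> \<beta> (u 0) * norm h"
proof -
  obtain f where f: "f holomorphic_on ball 0 1" "\<And>z. z \<in> ball 0 1 \<Longrightarrow> u z = Re (f z)"
    using harmonic_on_eq_Re_holomorphic[OF convex_ball assms(2)] by blast
  define c where "c = pi / (\<beta> - \<alpha>)"
  have c: "c > 0" using assms(1) by (simp add: c_def)
  define k where "k z = of_real c * (f z - of_real \<alpha>)" for z
  have f0: "(f has_field_derivative deriv f 0) (at 0)"
    using f by (intro holomorphic_derivI[of _ "ball 0 1"]) auto
  have k0: "(k has_field_derivative of_real c * deriv f 0) (at 0)"
    unfolding k_def by (rule derivative_eq_intros f0 refl | simp)+
  have "norm (deriv k 0) \<le> 2 * sin (Re (k 0))"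
  proof (rule norm_deriv_holomorphic_strip_le)
    show "k holomorphic_on ball 0 1"
      unfolding k_def by (intro holomorphic_intros f)
    show "0 < Re (k z) \<and> Re (k z) < pi" if "z \<in> ball 0 1" for z
      using bounds[OF that] f(2)[OF that] assms(1) by (simp add: k_def c_def field_simps)
  qed
  then have "c * norm (deriv f 0) \<le> 2 * sin (c * (u 0 - \<alpha>))"
    using DERIV_imp_deriv[OF k0] c f(2)[of 0] by (simp add: k_def norm_mult)
  then have le: "norm (deriv f 0) \<le> schwarz_bound \<alpha> \<beta> (u 0)"
    using assms(1) by (simp add: schwarz_bound_def c_def field_simps)
  have "((\<lambda>z. Re (f z)) has_derivative (\<lambda>h. Re (deriv f 0 * h))) (at 0)"
    using f0 by (intro bounded_linear.has_derivative[OF bounded_linear_Re])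
      (simp add: has_field_derivative_def)
  then have "(u has_derivative (\<lambda>h. Re (deriv f 0 * h))) (at 0)"
    by (rule has_derivative_transform_within_open[of _ _ _ _ "ball 0 1"]) (auto simp: f(2))
  then have "D h = Re (deriv f 0 * h)"
    using has_derivative_unique[OF D] by metis
  also have "\<bar>\<dots>\<bar> \<le> norm (deriv f 0) * norm h"
    using abs_Re_le_cmod[of "deriv f 0 * h"] by (simp add: norm_mult)
  also have "\<dots> \<le> schwarz_bound \<alpha> \<beta> (u 0) * norm h"
    using le by (intro mult_right_mono) auto
  finally show ?thesis .
qed

section \<open>Directions in which a linear map attains its norm\<close>

text \<open>Equality case of Cauchy-Schwarz: the vector representing \<open>L\<close> has norm at
  most \<open>A\<close>, and its component along \<open>v\<close> already has size \<open>A\<close>,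
  so nothing orthogonal to \<open>v\<close> remains.\<close>

lemma linear_functional_maximal_direction:
  fixes L :: "'a::euclidean_space \<Rightarrow> real"
  assumes "linear L" and bound: "\<And>w. \<bar>L w\<bar> \<le> A * norm w"
    and "norm v = 1" "\<bar>L v\<bar> = A"
  shows "L w = (v \<bullet> w) * L v"
proof -
  define g where "g = adjoint L 1"
  have L: "L w = g \<bullet> w" for w
    using adjoint_works[OF assms(1), of w 1] by (simp add: g_def inner_commute)
  have "A \<ge> 0" using assms(4) by simp
  \<comment> \<open>The bound is tested at \<open>g\<close> itself.\<close>
  have "norm g * norm g \<le> A * norm g"
    using bound[of g] by (simp add: L dot_square_norm power2_eq_square)
  then have "norm g \<le> A"
    using \<open>A \<ge> 0\<close> by (cases "g = 0") auto
  then have "g \<bullet> g \<le> (g \<bullet> v)\<^sup>2"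
    using assms(4) by (metis L dot_square_norm norm_ge_zero power2_abs power_mono)
  \<comment> \<open>By Pythagoras the left side is
    \<open>g \<bullet> g - (g \<bullet> v)\<^sup>2\<close>.\<close>
  then have "(g - (g \<bullet> v) *\<^sub>R v) \<bullet> (g - (g \<bullet> v) *\<^sub>R v) \<le> 0"
    using assms(3) by (simp add: algebra_simps power2_eq_square inner_commute norm_eq_1)
  then have "g = (g \<bullet> v) *\<^sub>R v"
    by (metis inner_eq_zero_iff inner_ge_zero order_antisym right_minus_eq)
  then have "g \<bullet> w = ((g \<bullet> v) *\<^sub>R v) \<bullet> w" by metis
  then show ?thesis
    by (simp add: L)
qed

text \<open>Compactness of the unit sphere gives a maximum there, and homogeneity extends it to all
  vectors.\<close>

lemma onorm_attained:
  fixes L :: "'a::euclidean_space \<Rightarrow> 'b::real_normed_vector"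
  assumes "bounded_linear L"
  obtains v where "norm v = 1" "norm (L v) = onorm L"
proof -
  interpret bounded_linear L by fact
  obtain v where v: "v \<in> sphere 0 1" "\<And>w. w \<in> sphere 0 1 \<Longrightarrow> norm (L w) \<le> norm (L v)"
    using continuous_attains_sup[of "sphere 0 1" "\<lambda>w. norm (L w)"]
    by (metis compact_sphere continuous_on_norm linear_continuous_on[OF assms]
        sphere_eq_empty not_one_less_zero DIM_positive)
  have "onorm L \<le> norm (L v)"
  proof (rule onorm_le)
    fix w
    show "norm (L w) \<le> norm (L v) * norm w"
    proof (cases "w = 0")
      case False
      then show ?thesis
        using v(2)[of "w /\<^sub>R norm w"] by (simp add: scaleR field_simps)
    qed (simp add: zero)
  qed
  moreover have "norm (L v) \<le> onorm L"
    using onorm[OF assms, of v] v(1) by simp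
  ultimately show thesis
    using that[of v] v(1) by simp
qed

section \<open>Rank of an extremal differential\<close>

theorem mainTheorem5:
  fixes a b p :: "real ^ 'n" and F :: "complex \<Rightarrow> real ^ 'n"
  assumes "\<And>j. a $ j < b $ j"
    and "p \<in> box a b"
    and "harmonic_map_on F (ball 0 1)"
    and "F \<in> ball 0 1 \<rightarrow> box a b"
    and "F 0 = p"
    and "extremal_at_0 a b p F"
  shows "dim (range (frechet_derivative F (at 0))) = 1"
proof -
  define F' where "F' = frechet_derivative F (at 0)"
  define A where "A j = schwarz_bound (a $ j) (b $ j) (p $ j)" for j
  \<comment> \<open>\<open>frechet_derivative\<close> is a choice that is meaningful only once a
    derivative exists; one is assembled from the components.\<close>
  have "\<exists>D. ((\<lambda>z. F z $ j) has_derivative D) (at 0)" for j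
    using assms(3) unfolding harmonic_map_on_def harmonic_on_def
    by (metis centre_in_ball zero_less_one)
  then obtain D where "\<And>j. ((\<lambda>z. F z $ j) has_derivative D j) (at 0)"
    by metis
  then have "(F has_derivative (\<lambda>h. \<chi> j. D j h)) (at 0)"
    by (subst has_derivative_componentwise_within)
      (auto simp: Basis_vec_def inner_axis)
  then have F': "(F has_derivative F') (at 0)"
    unfolding F'_def using differentiableI frechet_derivative_works by blast
  then have comp: "((\<lambda>z. F z $ j) has_derivative (\<lambda>h. F' h $ j)) (at 0)" for j
    by (rule bounded_linear.has_derivative[OF bounded_linear_vec_nth])
  have bound: "\<bar>F' h $ j\<bar> \<le> A j * norm h" for h j
    unfolding A_def assms(5)[symmetric]
    using assms(3,4) by (intro harmonic_schwarz comp assms(1))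
      (auto simp: harmonic_map_on_def mem_box_cart Pi_iff)
  \<comment> \<open>Since \<open>p\<close> lies in the open box, the argument of the sine is
    strictly between 0 and \<open>pi\<close>.\<close>
  have A_pos: "A j > 0" for j
    using assms(1)[of j] assms(2) unfolding A_def schwarz_bound_def
    by (intro mult_pos_pos sin_gt_zero) (auto simp: mem_box_cart field_simps)
  have bl: "bounded_linear F'"
    using F' has_derivative_bounded_linear by blast
  obtain v where v: "norm v = 1" "norm (F' v) = onorm F'"
    using onorm_attained[OF bl] by blast
  have "(\<Sum>j\<in>UNIV. (F' v $ j)\<^sup>2) = (\<Sum>j\<in>UNIV. (A j)\<^sup>2)"
    using v(2) assms(6) unfolding extremal_at_0_def F'_def[symmetric] A_def
    by (simp add: norm_vec_def L2_set_def)
  moreover have "(F' v $ j)\<^sup>2 \<le> (A j)\<^sup>2" for j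
    using bound[of v j] v(1) A_pos[of j] by (simp add: abs_le_square_iff[symmetric])
  \<comment> \<open>Termwise inequality together with equal finite sums forces equality in every
    term.\<close>
  ultimately have "(F' v $ j)\<^sup>2 = (A j)\<^sup>2" for j
    by (intro sum_mono_inv[of "\<lambda>j. (F' v $ j)\<^sup>2" UNIV "\<lambda>j. (A j)\<^sup>2"]) auto
  then have eq: "\<bar>F' v $ j\<bar> = A j" for j
    using A_pos[of j] by (metis abs_of_pos real_sqrt_abs)
  have "F' w = (v \<bullet> w) *\<^sub>R F' v" for w
  proof -
    have "F' w $ j = (v \<bullet> w) * F' v $ j" for j
      using bounded_linear_compose[OF bounded_linear_vec_nth bl] bound v(1) eq
      by (intro linear_functional_maximal_direction[of "\<lambda>h. F' h $ j" "A j"])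
        (auto intro: bounded_linear.linear)
    then show ?thesis by (simp add: vec_eq_iff)
  qed
  then have "range F' \<subseteq> span {F' v}"
    by (metis image_subsetI span_base span_scale singletonI)
  moreover have "F' v \<noteq> 0"
  proof
    assume "F' v = 0"
    \<comment> \<open>Any index will do; \<open>undefined\<close> just names one.\<close>
    then show False using eq[of undefined] A_pos[of undefined] by simp
  qed
  \<comment> \<open>The range contains \<open>F' v\<close> and lies in the line it spans.\<close>
  ultimately have "dim (range F') = dim {F' v}"
    by (intro antisym dim_mono dim_subset) auto
  also have "\<dots> = 1"
    using \<open>F' v \<noteq> 0\<close> by simp
  finally show ?thesis
    unfolding F'_def .
qed

end
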